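(* Let $p<n$. For every pointed, $n$-dimensional closed convex cone $C\subset\mathbb{R}^n$ and every nonempty compact set $\omega\subset\Omega=S^{n-1}\cap\operatorname{int}C^\circ$, there exist $K,L\in\mathcal{K}(C,\omega)$ with $K\neq L$ and $S_{p,\gamma^{n}}(K,\cdot)=S_{p,\gamma^{n}}(L,\cdot)$.
   Context: $C^\circ=\{x:\langle x,y\rangle\le 0\ \forall y\in C\}$. A $C$-pseudo-cone is a nonempty closed convex set $K\subset\mathbb{R}^n$ with $o\notin K$, $\lambda K\subseteq K$ for all $\lambda\ge1$, and recession cone $\{z:K+z\subseteq K\}=C$. Support function $h_K(u)=\sup_{y\in K}\langle u,y\rangle$ ($u\in C^\circ$). $\mathcal{K}(C,\omega)$ is the class of $C$-pseudo-cones $K$ with $K=C\cap\bigcap_{u\in\omega}\{x:\langle x,u\rangle\le h_K(u)\}$. For Borel $\eta\subset\Omega$, $S_{p,\gamma^n}(K,\eta)=(2\pi)^{-n/2}\int_{\nu_K^{-1}(\eta)}|\langle x,\nu_K(x)\rangle|^{1-p}e^{-|x|^2/2}\,d\mathcal H^{n-1}(x)$, where $\nu_K^{-1}(\eta)$ is the set of boundary points $x$ of $K$ with a unique outer unit normal $\nu_K(x)$ lying in $\eta$. *)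

theory Defs
  imports "HOL-Analysis.Analysis"
begin

section \<open>Convex cones and pseudo-cones\<close>

definition polar_cone :: "'a::euclidean_space set \<Rightarrow> 'a set" where
  "polar_cone C = {x. \<forall>y\<in>C. x \<bullet> y \<le> 0}"

definition pointed_cone :: "'a::euclidean_space set \<Rightarrow> bool" where
  "pointed_cone C \<longleftrightarrow> C \<inter> uminus ` C = {0}"

text \<open>Pointed, full-dimensional, closed convex cone.\<close>
definition pointed_full_cone :: "'a::euclidean_space set \<Rightarrow> bool" where
  "pointed_full_cone C \<longleftrightarrow> cone C \<and> convex C \<and> closed C \<and> pointed_cone C
      \<and> aff_dim C = int DIM('a)"

definition recession_cone :: "'a::euclidean_space set \<Rightarrow> 'a set" where
  "recession_cone K = {z. (\<lambda>y. y + z) ` K \<subseteq> K}"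

definition pseudo_cone :: "'a::euclidean_space set \<Rightarrow> 'a set \<Rightarrow> bool" where
  "pseudo_cone C K \<longleftrightarrow> K \<noteq> {} \<and> closed K \<and> convex K \<and> 0 \<notin> K
      \<and> (\<forall>t::real. t \<ge> 1 \<longrightarrow> (\<lambda>x. t *\<^sub>R x) ` K \<subseteq> K)
      \<and> recession_cone K = C"

definition support_fun :: "'a::euclidean_space set \<Rightarrow> 'a \<Rightarrow> real" where
  "support_fun K u = Sup ((\<lambda>y. u \<bullet> y) ` K)"

text \<open>The set Omega = S^{n-1} \<inter> int C\<degree>.\<close>
definition Omega :: "'a::euclidean_space set \<Rightarrow> 'a set" where
  "Omega C = sphere 0 1 \<inter> interior (polar_cone C)"

text \<open>The class K(C, omega).\<close>
definition Kclass :: "'a::euclidean_space set \<Rightarrow> 'a set \<Rightarrow> 'a set set" where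
  "Kclass C \<omega> = {K. pseudo_cone C K \<and>
      K = C \<inter> (\<Inter>u\<in>\<omega>. {x. x \<bullet> u \<le> support_fun K u})}"

section \<open>Outer unit normals\<close>

definition outer_unit_normals :: "'a::euclidean_space set \<Rightarrow> 'a \<Rightarrow> 'a set" where
  "outer_unit_normals K x = {u. norm u = 1 \<and> (\<forall>y\<in>K. u \<bullet> y \<le> u \<bullet> x)}"

definition unit_normal :: "'a::euclidean_space set \<Rightarrow> 'a \<Rightarrow> 'a" where
  "unit_normal K x = (THE u. u \<in> outer_unit_normals K x)"

text \<open>Boundary points with a unique outer unit normal, that normal lying in eta.\<close>
definition inv_normal :: "'a::euclidean_space set \<Rightarrow> 'a set \<Rightarrow> 'a set" where
  "inv_normal K \<eta> = {x \<in> frontier K. \<exists>u. outer_unit_normals K x = {u} \<and> u \<in> \<eta>}"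

section \<open>Hausdorff measure\<close>

text \<open>Normalising constant so that H^s agrees with Lebesgue measure on R^s.\<close>
definition hausdorff_const :: "nat \<Rightarrow> real" where
  "hausdorff_const s = pi powr (real s / 2) / (Gamma (real s / 2 + 1) * 2 ^ s)"

text \<open>Convention: diam(U)^s is 0 for empty U, and diam^0 = 1 for nonempty U.\<close>
definition hausdorff_pre :: "nat \<Rightarrow> real \<Rightarrow> 'a::euclidean_space set \<Rightarrow> ennreal" where
  "hausdorff_pre s \<delta> A = (INF U \<in> {U :: nat \<Rightarrow> 'a set. A \<subseteq> (\<Union>i. U i) \<and> (\<forall>i. diameter (U i) \<le> \<delta>)}.
      (\<Sum>i. ennreal (if U i = {} then 0 else hausdorff_const s * diameter (U i) ^ s)))"

definition hausdorff_outer :: "nat \<Rightarrow> 'a::euclidean_space set \<Rightarrow> ennreal" where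
  "hausdorff_outer s A = (SUP \<delta> \<in> {0<..}. hausdorff_pre s \<delta> A)"

text \<open>s-dimensional Hausdorff measure on the Borel sets.\<close>
definition hausdorff_measure :: "nat \<Rightarrow> 'a::euclidean_space measure" where
  "hausdorff_measure s = measure_of UNIV (sets borel) (hausdorff_outer s)"

section \<open>Gaussian L_p surface area measure\<close>

definition gauss_Lp_area :: "real \<Rightarrow> 'a::euclidean_space set \<Rightarrow> 'a set \<Rightarrow> ennreal" where
  "gauss_Lp_area p K \<eta> =
     ennreal ((2 * pi) powr (- real DIM('a) / 2)) *
     (\<integral>\<^sup>+ x. indicator (inv_normal K \<eta>) x *
        ennreal (\<bar>x \<bullet> unit_normal K x\<bar> powr (1 - p) * exp (- (norm x)\<^sup>2 / 2))
      \<partial>hausdorff_measure (DIM('a) - 1))"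

end

theory Submission
  imports Defs "HOL-Real_Asymp.Real_Asymp"
begin

(*
  Fix u in omega and cut C by the hyperplanes <u, x> = -t, t > 0:
  K_t = C \<inter> {x. <u, x> <= -t}.  Every K_t belongs to K(C, omega).  As <v, x> < 0 for v in
  int C^o and x in C - {0}, no outer normal of C at a nonzero boundary point lies in Omega, so the
  boundary points of K_t with a unique outer normal in Omega are exactly the points of the facet
  F_t = int C \<inter> {<u, x> = -t}, where the normal is u and |<x, u>| = t.  Hence
  S_{p,gamma}(K_t, .) is a point mass at u of size (2 pi)^(-n/2) t^(n-p) J(t), where
  J(t) = integral over F_1 of exp(-t^2 |y|^2 / 2) dH^(n-1), by the (n-1)-homogeneity of
  Hausdorff measure and F_t = t F_1.  If H^(n-1)(F_1) is 0 or infinite, all these masses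
  agree.  Otherwise g(t) = t^(n-p) J(t) is continuous and positive, and since p < n and F_1 lies
  in an annulus 1 <= |y| <= R, g tends to 0 both as t -> 0 and as t -> infinity; so g takes
  some value at two different t.
*)

section \<open>Homogeneity of the Hausdorff measure\<close>

text \<open>Both sides are the junk value \<open>LEAST z. False\<close>.\<close>
lemma Sup_real_not_bdd_above_eq:
  fixes X Y :: "real set"
  assumes "\<not> bdd_above X" "\<not> bdd_above Y"
  shows "Sup X = Sup Y"
proof -
  have "(\<lambda>z. \<forall>x\<in>X. x \<le> z) = (\<lambda>z. \<forall>y\<in>Y. y \<le> z)"
    using assms by (auto simp: bdd_above_def fun_eq_iff)
  then show ?thesis unfolding Sup_real_def by simp
qed

lemma not_bdd_above_dist_not_bounded:
  fixes S :: "'a::metric_space set"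
  assumes "\<not> bounded S"
  shows "\<not> bdd_above ((\<lambda>(x,y). dist x y) ` (S \<times> S))"
proof
  assume "bdd_above ((\<lambda>(x,y). dist x y) ` (S \<times> S))"
  then obtain B where B: "\<And>x y. x \<in> S \<Longrightarrow> y \<in> S \<Longrightarrow> dist x y \<le> B"
    by (auto simp: bdd_above_def)
  obtain x0 where "x0 \<in> S" using assms by (metis bounded_empty ex_in_conv)
  then have "bounded S" unfolding bounded_def using B by blast
  with assms show False by simp
qed

lemma diameter_not_bounded_eq:
  fixes U V :: "'a::metric_space set"
  assumes "\<not> bounded U" "\<not> bounded V"
  shows "diameter U = diameter V"
proof -
  have "U \<noteq> {}" "V \<noteq> {}" using assms by auto
  then show ?thesis
    unfolding diameter_def using Sup_real_not_bdd_above_eq[OF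
      not_bdd_above_dist_not_bounded[OF assms(1)] not_bdd_above_dist_not_bounded[OF assms(2)]]
    by simp
qed

lemma diameter_scaleR:
  fixes U :: "'a::real_normed_vector set"
  assumes "bounded U" "t > 0"
  shows "diameter ((*\<^sub>R) t ` U) = t * diameter U"
proof (cases "U = {}")
  case False
  have bounded_image: "bounded ((*\<^sub>R) t ` U)"
    using assms by (simp add: bounded_scaling)
  have dist_scaleR: "dist (t *\<^sub>R x) (t *\<^sub>R y) = t * dist x y" for x y :: 'a
    using assms(2) by (simp add: dist_norm flip: scaleR_diff_right)
  have "diameter ((*\<^sub>R) t ` U) \<le> t * diameter U"
  proof (rule diameter_le)
    show "(*\<^sub>R) t ` U \<noteq> {} \<or> 0 \<le> t * diameter U" using False by auto
    fix x y assume "x \<in> (*\<^sub>R) t ` U" "y \<in> (*\<^sub>R) t ` U"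
    then obtain a b where "a \<in> U" "b \<in> U" "x = t *\<^sub>R a" "y = t *\<^sub>R b" by auto
    then show "norm (x - y) \<le> t * diameter U"
      using diameter_bounded_bound[OF assms(1)] dist_scaleR assms(2)
      by (metis dist_norm mult_left_mono less_imp_le)
  qed
  moreover have "diameter U \<le> diameter ((*\<^sub>R) t ` U) / t"
  proof (rule diameter_le)
    show "U \<noteq> {} \<or> 0 \<le> diameter ((*\<^sub>R) t ` U) / t" using False by auto
    fix x y assume "x \<in> U" "y \<in> U"
    then have "t * norm (x - y) \<le> diameter ((*\<^sub>R) t ` U)"
      using diameter_bounded_bound[OF bounded_image] dist_scaleR by (metis dist_norm imageI)
    then show "norm (x - y) \<le> diameter ((*\<^sub>R) t ` U) / t"
      using assms(2) by (simp add: field_simps)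
  qed
  ultimately show ?thesis using assms(2) by (simp add: field_simps)
qed simp

lemma diameter_translation:
  fixes U :: "'a::real_normed_vector set"
  shows "diameter ((+) v ` U) = diameter U"
proof -
  have "(\<lambda>(x,y). dist x y) ` ((+) v ` U \<times> (+) v ` U) = (\<lambda>(x,y). dist x y) ` (U \<times> U)"
    by (auto simp: image_iff dist_norm) (metis add_diff_cancel_left)+
  then show ?thesis unfolding diameter_def by simp
qed

lemma ennreal_INF_cmult_le:
  fixes c :: ennreal
  assumes "0 < c" "c < top"
  shows "(INF x\<in>X. c * f x) \<le> c * (INF x\<in>X. f x)"
proof -
  let ?m = "INF x\<in>X. c * f x"
  have c_inverse: "c * inverse c = 1"
    using assms divide_ennreal_def ennreal_divide_self top.not_eq_extremum by auto
  have "?m * inverse c \<le> f x" if "x \<in> X" for x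
  proof -
    have "?m * inverse c \<le> c * f x * inverse c"
      by (rule mult_right_mono) (use that in \<open>auto intro: INF_lower\<close>)
    also have "\<dots> = f x" using c_inverse by (metis mult.assoc mult.commute mult_1)
    finally show ?thesis .
  qed
  then have "c * (?m * inverse c) \<le> c * (INF x\<in>X. f x)"
    by (intro mult_left_mono INF_greatest) simp_all
  moreover have "c * (?m * inverse c) = ?m" using c_inverse by (metis mult.assoc mult.commute mult_1)
  ultimately show ?thesis by simp
qed

definition hausdorff_covers :: "real \<Rightarrow> 'a::euclidean_space set \<Rightarrow> (nat \<Rightarrow> 'a set) set" where
  "hausdorff_covers \<delta> A = {U. A \<subseteq> (\<Union>i. U i) \<and> (\<forall>i. diameter (U i) \<le> \<delta>)}"

definition hausdorff_sum :: "nat \<Rightarrow> (nat \<Rightarrow> 'a::euclidean_space set) \<Rightarrow> ennreal" where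
  "hausdorff_sum s U = (\<Sum>i. ennreal (if U i = {} then 0 else hausdorff_const s * diameter (U i) ^ s))"

lemma hausdorff_pre_eq_INF: "hausdorff_pre s \<delta> A = (INF U\<in>hausdorff_covers \<delta> A. hausdorff_sum s U)"
  by (simp add: hausdorff_pre_def hausdorff_sum_def hausdorff_covers_def)

lemma hausdorff_const_nonneg: "0 \<le> hausdorff_const s"
  unfolding hausdorff_const_def by (intro divide_nonneg_pos mult_pos_pos) (auto intro: Gamma_real_pos)

lemma hausdorff_sum_scaleR:
  assumes "t > 0" "\<And>i. bounded (U i)"
  shows "hausdorff_sum s (\<lambda>i. (*\<^sub>R) t ` U i) = ennreal (t ^ s) * hausdorff_sum s U"
proof -
  have "ennreal (if (*\<^sub>R) t ` U i = {} then 0 else hausdorff_const s * diameter ((*\<^sub>R) t ` U i) ^ s)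
      = ennreal (t ^ s) * ennreal (if U i = {} then 0 else hausdorff_const s * diameter (U i) ^ s)" for i
  proof (cases "U i = {}")
    case False
    have "0 \<le> hausdorff_const s * diameter (U i) ^ s"
      using hausdorff_const_nonneg diameter_ge_0[OF assms(2)] by simp
    then show ?thesis
      using False assms diameter_scaleR[OF assms(2) assms(1)]
      by (simp add: power_mult_distrib mult.left_commute flip: ennreal_mult)
  qed simp
  then show ?thesis unfolding hausdorff_sum_def by simp
qed

text \<open>The bound \<open>\<delta>' < diameter UNIV\<close> forces the covering sets to be bounded: the diameter
  of an unbounded set is a junk value, which does not scale.\<close>
lemma hausdorff_pre_scaleR_le:
  fixes A :: "'a::euclidean_space set"
  assumes "t > 0" "0 < \<delta>'" "\<delta>' < diameter (UNIV::'a set)" "t * \<delta>' \<le> \<delta>"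
  shows "hausdorff_pre s \<delta> ((*\<^sub>R) t ` A) \<le> ennreal (t ^ s) * hausdorff_pre s \<delta>' A"
  unfolding hausdorff_pre_eq_INF
proof (rule order_trans[OF INF_mono ennreal_INF_cmult_le])
  fix V assume V: "V \<in> hausdorff_covers \<delta>' A"
  have bounded: "bounded (V i)" for i
  proof (rule ccontr)
    assume "\<not> bounded (V i)"
    then have "diameter (V i) = diameter (UNIV::'a set)" by (rule diameter_not_bounded_eq) simp
    moreover have "diameter (V i) \<le> \<delta>'" using V by (simp add: hausdorff_covers_def)
    ultimately show False using assms(3) by simp
  qed
  have "t * diameter (V i) \<le> \<delta>" for i
    using V assms(1,4) by (auto simp: hausdorff_covers_def intro: order_trans[OF mult_left_mono])
  moreover have "(*\<^sub>R) t ` A \<subseteq> (\<Union>i. (*\<^sub>R) t ` V i)"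
    using V unfolding hausdorff_covers_def by blast
  ultimately have "(\<lambda>i. (*\<^sub>R) t ` V i) \<in> hausdorff_covers \<delta> ((*\<^sub>R) t ` A)"
    by (simp add: hausdorff_covers_def diameter_scaleR[OF bounded assms(1)])
  then show "\<exists>W\<in>hausdorff_covers \<delta> ((*\<^sub>R) t ` A). hausdorff_sum s W \<le> ennreal (t ^ s) * hausdorff_sum s V"
    using hausdorff_sum_scaleR[OF assms(1) bounded] by (intro bexI) simp_all
qed (use assms(1) in auto)

lemma hausdorff_outer_scaleR_le:
  fixes A :: "'a::euclidean_space set"
  assumes "diameter (UNIV::'a set) > 0" "t > 0"
  shows "hausdorff_outer s ((*\<^sub>R) t ` A) \<le> ennreal (t ^ s) * hausdorff_outer s A"
  unfolding hausdorff_outer_def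
proof (rule SUP_least)
  fix \<delta> :: real assume "\<delta> \<in> {0<..}"
  define \<delta>' where "\<delta>' = min (\<delta> / t) (diameter (UNIV::'a set) / 2)"
  have \<delta>': "0 < \<delta>'" "\<delta>' < diameter (UNIV::'a set)" "t * \<delta>' \<le> \<delta>"
    using \<open>\<delta> \<in> {0<..}\<close> assms by (auto simp: \<delta>'_def min_def field_simps)
  have "hausdorff_pre s \<delta> ((*\<^sub>R) t ` A) \<le> ennreal (t ^ s) * hausdorff_pre s \<delta>' A"
    by (rule hausdorff_pre_scaleR_le[OF assms(2) \<delta>'])
  also have "\<dots> \<le> ennreal (t ^ s) * (SUP \<delta>\<in>{0<..}. hausdorff_pre s \<delta> A)"
    by (intro mult_left_mono SUP_upper) (use \<delta>' in auto)
  finally show "hausdorff_pre s \<delta> ((*\<^sub>R) t ` A) \<le> ennreal (t ^ s) * (SUP \<delta>\<in>{0<..}. hausdorff_pre s \<delta> A)" .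
qed

lemma hausdorff_outer_scaleR:
  fixes A :: "'a::euclidean_space set"
  assumes "diameter (UNIV::'a set) > 0" "t > 0"
  shows "hausdorff_outer s ((*\<^sub>R) t ` A) = ennreal (t ^ s) * hausdorff_outer s A"
proof (rule antisym)
  show "hausdorff_outer s ((*\<^sub>R) t ` A) \<le> ennreal (t ^ s) * hausdorff_outer s A"
    by (rule hausdorff_outer_scaleR_le[OF assms])
  have "(*\<^sub>R) (1/t) ` (*\<^sub>R) t ` A = A"
    using assms(2) by (force simp: image_image)
  then have "hausdorff_outer s A \<le> ennreal ((1/t) ^ s) * hausdorff_outer s ((*\<^sub>R) t ` A)"
    using hausdorff_outer_scaleR_le[OF assms(1), of "1/t" s "(*\<^sub>R) t ` A"] assms(2) by simp
  then have "ennreal (t ^ s) * hausdorff_outer s A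
      \<le> ennreal (t ^ s) * ennreal ((1/t) ^ s) * hausdorff_outer s ((*\<^sub>R) t ` A)"
    by (simp add: mult_left_mono mult.assoc)
  also have "ennreal (t ^ s) * ennreal ((1/t) ^ s) = 1"
    using assms(2) by (simp flip: ennreal_mult power_mult_distrib)
  finally show "ennreal (t ^ s) * hausdorff_outer s A \<le> hausdorff_outer s ((*\<^sub>R) t ` A)" by simp
qed

lemma hausdorff_pre_translation_le:
  "hausdorff_pre s \<delta> ((+) v ` A) \<le> hausdorff_pre s \<delta> A"
  unfolding hausdorff_pre_eq_INF
proof (rule INF_mono)
  fix V assume "V \<in> hausdorff_covers \<delta> A"
  then have "(\<lambda>i. (+) v ` V i) \<in> hausdorff_covers \<delta> ((+) v ` A)"
    by (auto simp: hausdorff_covers_def diameter_translation) blast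
  moreover have "hausdorff_sum s (\<lambda>i. (+) v ` V i) = hausdorff_sum s V"
    unfolding hausdorff_sum_def by (simp only: diameter_translation image_is_empty)
  ultimately show "\<exists>W\<in>hausdorff_covers \<delta> ((+) v ` A). hausdorff_sum s W \<le> hausdorff_sum s V"
    by (intro bexI) simp_all
qed

lemma hausdorff_outer_translation: "hausdorff_outer s ((+) v ` A) = hausdorff_outer s A"
proof -
  have "hausdorff_pre s \<delta> ((+) v ` A) = hausdorff_pre s \<delta> A" for \<delta>
  proof (rule antisym)
    show "hausdorff_pre s \<delta> A \<le> hausdorff_pre s \<delta> ((+) v ` A)"
      using hausdorff_pre_translation_le[of s \<delta> "-v" "(+) v ` A"] by (simp add: image_image)
  qed (rule hausdorff_pre_translation_le)
  then show ?thesis by (simp add: hausdorff_outer_def)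
qed

lemma hausdorff_outer_UNIV_finite:
  assumes "diameter (UNIV::'a::euclidean_space set) \<le> 0"
  shows "hausdorff_outer s (UNIV::'a set) < \<infinity>"
proof -
  let ?U = "\<lambda>i::nat. if i = 0 then (UNIV::'a set) else {}"
  let ?c = "ennreal (hausdorff_const s * diameter (UNIV::'a set) ^ s)"
  have sum_eq: "hausdorff_sum s ?U = ?c"
    unfolding hausdorff_sum_def by (subst suminf_finite[of "{0}"]) auto
  have cover: "?U \<in> hausdorff_covers \<delta> UNIV" if "\<delta> > 0" for \<delta>
    using assms that by (auto simp: hausdorff_covers_def)
  have "hausdorff_pre s \<delta> (UNIV::'a set) \<le> ?c" if "\<delta> > 0" for \<delta>
    unfolding hausdorff_pre_eq_INF by (rule INF_lower2[OF cover[OF that]]) (simp add: sum_eq)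
  then have "hausdorff_outer s (UNIV::'a set) \<le> ?c"
    unfolding hausdorff_outer_def by (intro SUP_least) simp
  then show ?thesis using le_less_trans[OF _ ennreal_less_top] by simp
qed

lemma sets_hausdorff_measure [simp, measurable_cong]:
  "sets (hausdorff_measure s :: 'a::euclidean_space measure) = sets borel"
  unfolding hausdorff_measure_def
  using sets.sigma_sets_eq[of "borel :: 'a measure"] by (simp add: sets_measure_of_conv)

lemma space_hausdorff_measure [simp]: "space (hausdorff_measure s :: 'a::euclidean_space measure) = UNIV"
  using sets_eq_imp_space_eq[OF sets_hausdorff_measure] by simp

text \<open>\<open>measure_of\<close> yields the zero measure unless the outer measure is countably additive
  on the Borel sets.\<close>
lemma emeasure_hausdorff_measure:
  fixes A :: "'a::euclidean_space set"
  shows "emeasure (hausdorff_measure s) A =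
    (if A \<in> sets borel \<and> measure_space UNIV (sets borel) (hausdorff_outer s :: 'a set \<Rightarrow> ennreal)
     then hausdorff_outer s A else 0)"
proof -
  have "sigma_sets UNIV (sets borel) = sets (borel :: 'a measure)"
    using sets.sigma_sets_eq[of "borel :: 'a measure"] by simp
  then show ?thesis unfolding hausdorff_measure_def by (simp only: emeasure_measure_of_conv)
qed

lemma image_scaleR_eq_vimage:
  fixes A :: "'a::real_vector set"
  assumes "c \<noteq> 0"
  shows "(*\<^sub>R) c ` A = (*\<^sub>R) (inverse c) -` A"
proof (intro set_eqI iffI)
  fix x assume "x \<in> (*\<^sub>R) (inverse c) -` A"
  then show "x \<in> (*\<^sub>R) c ` A" using assms by (intro image_eqI[of _ _ "inverse c *\<^sub>R x"]) auto
qed (use assms in auto)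

lemma image_add_eq_vimage:
  fixes A :: "'a::ab_group_add set"
  shows "(+) v ` A = (+) (- v) -` A"
proof (intro set_eqI iffI)
  fix x assume "x \<in> (+) (- v) -` A"
  then show "x \<in> (+) v ` A" by (intro image_eqI[of _ _ "- v + x"]) auto
qed auto

lemma sets_borel_image_scaleR:
  fixes A :: "'a::euclidean_space set"
  assumes "A \<in> sets borel" "c \<noteq> 0"
  shows "(*\<^sub>R) c ` A \<in> sets borel"
  unfolding image_scaleR_eq_vimage[OF assms(2)]
  by (rule measurable_sets_borel[OF _ assms(1)]) (intro borel_measurable_continuous_onI continuous_intros)

lemma sets_borel_image_translation:
  fixes A :: "'a::euclidean_space set"
  assumes "A \<in> sets borel"
  shows "(+) v ` A \<in> sets borel"
  unfolding image_add_eq_vimage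
  by (rule measurable_sets_borel[OF _ assms(1)]) (intro borel_measurable_continuous_onI continuous_intros)

lemma suminf_ennreal_const_eq_top:
  fixes c :: ennreal
  assumes "c \<noteq> 0"
  shows "(\<Sum>i::nat. c) = \<infinity>"
proof -
  have "(\<Sum>i::nat. c) = (\<integral>\<^sup>+i. c \<partial>count_space (UNIV::nat set))"
    by (simp only: nn_integral_count_space_nat)
  also have "\<dots> = c * \<infinity>"
    using emeasure_count_space_infinite[OF subset_refl infinite_UNIV_nat] by (simp add: nn_integral_const)
  finally show ?thesis using assms by (simp add: ennreal_mult_top)
qed

lemma disjoint_translates_bounded:
  fixes A :: "'a::euclidean_space set"
  assumes "bounded A"
  obtains v where "disjoint_family (\<lambda>j::nat. (+) (real j *\<^sub>R v) ` A)"
proof -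
  obtain R where R: "R > 0" "\<And>x. x \<in> A \<Longrightarrow> norm x \<le> R"
    using assms bounded_pos by blast
  obtain e :: 'a where e: "e \<in> Basis" using nonempty_Basis by blast
  define v where "v = (3 * R) *\<^sub>R e"
  have "(+) (real i *\<^sub>R v) ` A \<inter> (+) (real j *\<^sub>R v) ` A = {}" if "i \<noteq> j" for i j
  proof (rule ccontr)
    assume "(+) (real i *\<^sub>R v) ` A \<inter> (+) (real j *\<^sub>R v) ` A \<noteq> {}"
    then obtain a b where ab: "a \<in> A" "b \<in> A" "real i *\<^sub>R v + a = real j *\<^sub>R v + b" by blast
    then have "(real i - real j) *\<^sub>R v = b - a" by (simp add: algebra_simps)
    then have "\<bar>real i - real j\<bar> * (3 * R) = norm (b - a)"
      using R(1) e by (metis v_def abs_mult abs_of_pos norm_Basis norm_scaleR mult_1_right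
          mult_pos_pos zero_less_numeral)
    also have "\<dots> \<le> 2 * R"
      using R(2)[OF ab(1)] R(2)[OF ab(2)] norm_triangle_ineq4[of b a] by linarith
    finally have "\<bar>real i - real j\<bar> * (3 * R) \<le> 2 * R" .
    moreover have "1 * (3 * R) \<le> \<bar>real i - real j\<bar> * (3 * R)"
      using that R(1) by (intro mult_right_mono) linarith+
    ultimately show False using R(1) by linarith
  qed
  then show ?thesis using that unfolding disjoint_family_on_def by blast
qed

text \<open>Infinitely many disjoint translates of a bounded set of positive measure would have
  infinite total measure.\<close>
lemma emeasure_eq_0_if_translation_invariant_finite:
  fixes M :: "'a::euclidean_space measure"
  assumes sets_M: "sets M = sets borel" and finite: "emeasure M UNIV < \<infinity>"
    and invariant: "\<And>A v. A \<in> sets borel \<Longrightarrow> emeasure M ((+) v ` A) = emeasure M A"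
    and B: "B \<in> sets borel"
  shows "emeasure M B = 0"
proof -
  have bounded_null: "emeasure M A = 0" if A: "A \<in> sets borel" "bounded A" for A
  proof (rule ccontr)
    assume nonzero: "emeasure M A \<noteq> 0"
    obtain v where disjoint: "disjoint_family (\<lambda>j::nat. (+) (real j *\<^sub>R v) ` A)"
      using disjoint_translates_bounded[OF A(2)] .
    have "\<infinity> = (\<Sum>j::nat. emeasure M A)"
      using suminf_ennreal_const_eq_top[OF nonzero] by simp
    also have "\<dots> = (\<Sum>j. emeasure M ((+) (real j *\<^sub>R v) ` A))"
      using invariant[OF A(1)] by simp
    also have "\<dots> = emeasure M (\<Union>j. (+) (real j *\<^sub>R v) ` A)"
      using disjoint sets_borel_image_translation[OF A(1)] sets_M
      by (intro suminf_emeasure) auto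
    also have "\<dots> \<le> emeasure M UNIV"
      using sets_M by (intro emeasure_mono) auto
    finally show False using finite by simp
  qed
  have "B = (\<Union>k::nat. B \<inter> cball 0 (real k))"
  proof (intro antisym subsetI)
    fix x assume "x \<in> B"
    obtain k :: nat where "norm x \<le> real k" using real_arch_simple by blast
    then show "x \<in> (\<Union>k::nat. B \<inter> cball 0 (real k))" using \<open>x \<in> B\<close> by auto
  qed auto
  also have "emeasure M \<dots> = 0"
  proof (rule emeasure_UN_eq_0)
    have pieces: "B \<inter> cball 0 r \<in> sets borel" for r
      by (intro sets.Int B borel_closed closed_cball)
    then show "emeasure M (B \<inter> cball 0 (real k)) = 0" for k
      by (rule bounded_null[OF _ bounded_Int[OF disjI2[OF bounded_cball]]])
    show "range (\<lambda>k. B \<inter> cball 0 (real k)) \<subseteq> sets M" using pieces sets_M by auto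
  qed
  finally show ?thesis .
qed

lemma emeasure_hausdorff_measure_scaleR:
  fixes A :: "'a::euclidean_space set"
  assumes A: "A \<in> sets borel" and t: "t > 0"
  shows "emeasure (hausdorff_measure s) ((*\<^sub>R) t ` A) = ennreal (t ^ s) * emeasure (hausdorff_measure s) A"
proof -
  have tA: "(*\<^sub>R) t ` A \<in> sets borel" using sets_borel_image_scaleR[OF A] t by simp
  consider "\<not> measure_space UNIV (sets borel) (hausdorff_outer s :: 'a set \<Rightarrow> ennreal)"
    | "measure_space UNIV (sets borel) (hausdorff_outer s :: 'a set \<Rightarrow> ennreal)" "diameter (UNIV::'a set) > 0"
    | "measure_space UNIV (sets borel) (hausdorff_outer s :: 'a set \<Rightarrow> ennreal)" "diameter (UNIV::'a set) \<le> 0"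
    by fastforce
  then show ?thesis
  proof cases
    case 1
    then show ?thesis by (simp add: emeasure_hausdorff_measure)
  next
    case 2
    then show ?thesis using A tA t by (simp add: emeasure_hausdorff_measure hausdorff_outer_scaleR)
  next
    case 3
    txt \<open>The diameter of the whole space is a junk value; if it is not positive, the
      measure is finite and translation invariant, hence zero.\<close>
    have "emeasure (hausdorff_measure s) B = 0" if "B \<in> sets borel" for B :: "'a set"
    proof (rule emeasure_eq_0_if_translation_invariant_finite[OF _ _ _ that])
      show "emeasure (hausdorff_measure s :: 'a measure) UNIV < \<infinity>"
        using hausdorff_outer_UNIV_finite[OF 3(2)] by (simp add: emeasure_hausdorff_measure)
      show "emeasure (hausdorff_measure s) ((+) v ` A') = emeasure (hausdorff_measure s) A'"
        if "A' \<in> sets borel" for A' :: "'a set" and v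
        using that sets_borel_image_translation[OF that]
        by (simp add: emeasure_hausdorff_measure hausdorff_outer_translation)
    qed simp
    then show ?thesis using A tA by simp
  qed
qed

lemma distr_hausdorff_measure_scaleR:
  assumes t: "t > 0"
  shows "distr (hausdorff_measure s) borel ((*\<^sub>R) t)
    = density (hausdorff_measure s :: 'a::euclidean_space measure) (\<lambda>_. ennreal ((1/t) ^ s))"
proof (rule measure_eqI)
  fix A :: "'a set" assume "A \<in> sets (distr (hausdorff_measure s) borel ((*\<^sub>R) t))"
  then have A: "A \<in> sets borel" by simp
  have "(*\<^sub>R) t -` A = (*\<^sub>R) (1/t) ` A"
    using image_scaleR_eq_vimage[of "inverse t" A] t by (simp add: divide_inverse)
  then have "emeasure (distr (hausdorff_measure s) borel ((*\<^sub>R) t)) A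
      = ennreal ((1/t) ^ s) * emeasure (hausdorff_measure s) A"
    using A t by (simp add: emeasure_distr emeasure_hausdorff_measure_scaleR)
  also have "\<dots> = emeasure (density (hausdorff_measure s) (\<lambda>_. ennreal ((1/t) ^ s))) A"
    using A by (simp add: emeasure_density nn_integral_cmult_indicator)
  finally show "emeasure (distr (hausdorff_measure s) borel ((*\<^sub>R) t)) A
      = emeasure (density (hausdorff_measure s) (\<lambda>_. ennreal ((1/t) ^ s))) A" .
qed simp

lemma nn_integral_hausdorff_measure_scaleR:
  fixes f :: "'a::euclidean_space \<Rightarrow> ennreal"
  assumes f: "f \<in> borel_measurable borel" and t: "t > 0"
  shows "(\<integral>\<^sup>+x. f x \<partial>hausdorff_measure s) = ennreal (t ^ s) * (\<integral>\<^sup>+y. f (t *\<^sub>R y) \<partial>hausdorff_measure s)"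
proof -
  have "(\<integral>\<^sup>+y. f (t *\<^sub>R y) \<partial>hausdorff_measure s) = (\<integral>\<^sup>+x. f x \<partial>distr (hausdorff_measure s) borel ((*\<^sub>R) t))"
    using f by (intro nn_integral_distr[symmetric]) auto
  also have "\<dots> = ennreal ((1/t) ^ s) * (\<integral>\<^sup>+x. f x \<partial>hausdorff_measure s)"
    using f by (simp add: distr_hausdorff_measure_scaleR[OF t] nn_integral_density nn_integral_cmult)
  finally have "ennreal (t ^ s) * (\<integral>\<^sup>+y. f (t *\<^sub>R y) \<partial>hausdorff_measure s)
      = ennreal (t ^ s) * ennreal ((1/t) ^ s) * (\<integral>\<^sup>+x. f x \<partial>hausdorff_measure s)"
    by (simp add: mult.assoc)
  also have "ennreal (t ^ s) * ennreal ((1/t) ^ s) = 1"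
    using t by (simp flip: ennreal_mult power_mult_distrib)
  finally show ?thesis by simp
qed

section \<open>Functions vanishing at both ends of the half-line\<close>

lemma not_inj_on_if_vanishing_at_0_and_top:
  fixes g :: "real \<Rightarrow> real"
  assumes cont: "continuous_on {0<..} g" and pos: "\<And>t. t > 0 \<Longrightarrow> g t > 0"
    and at_0: "(g \<longlongrightarrow> 0) (at_right 0)" and at_top: "(g \<longlongrightarrow> 0) at_top"
  shows "\<not> inj_on g {0<..}"
proof -
  have "g 1 > 0" by (rule pos) simp
  obtain b where b: "b > 0" "\<And>t. 0 < t \<Longrightarrow> t < b \<Longrightarrow> g t < g 1"
    using order_tendstoD(2)[OF at_0 \<open>g 1 > 0\<close>] unfolding eventually_at_right_field by auto
  define a where "a = min (b / 2) (1 / 2)"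
  have a: "0 < a" "a < 1" "g a < g 1" using b unfolding a_def by auto
  obtain N where N: "\<And>t. t \<ge> N \<Longrightarrow> g t < g 1"
    using order_tendstoD(2)[OF at_top \<open>g 1 > 0\<close>] unfolding eventually_at_top_linorder by auto
  define c where "c = max N 2"
  have c: "1 < c" "g c < g 1" using N unfolding c_def by auto
  define y where "y = max (g a) (g c)"
  have y: "g a \<le> y" "g c \<le> y" "y < g 1" using a c unfolding y_def by auto
  have "continuous_on {a..1} g" "continuous_on {1..c} g"
    using a c by (auto intro: continuous_on_subset[OF cont])
  then obtain t1 t2 where t1: "a \<le> t1" "t1 \<le> 1" "g t1 = y" and t2: "1 \<le> t2" "t2 \<le> c" "g t2 = y"
    using IVT'[of g a y 1] IVT2'[of g c y 1] y a c by auto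
  have "t1 \<noteq> 1" "t2 \<noteq> 1" using t1 t2 y by auto
  then have "t1 \<in> {0<..}" "t2 \<in> {0<..}" "t1 \<noteq> t2" "g t1 = g t2"
    using a t1 t2 by auto
  then show ?thesis unfolding inj_on_def by blast
qed

lemma continuous_on_if_diff_le_diff_squares:
  fixes f :: "real \<Rightarrow> real"
  assumes f: "\<And>a b. 0 \<le> a \<Longrightarrow> a \<le> b \<Longrightarrow> \<bar>f a - f b\<bar> \<le> (b\<^sup>2 - a\<^sup>2) * c" and "c \<ge> 0"
  shows "continuous_on {0<..} f"
proof -
  have lipschitz: "(2 * b * c)-lipschitz_on {0..b} f" if "b > 0" for b
  proof (rule lipschitz_onI)
    have key: "\<bar>f x - f y\<bar> \<le> 2 * b * c * (y - x)" if "0 \<le> x" "x \<le> y" "y \<le> b" for x y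
    proof -
      have "\<bar>f x - f y\<bar> \<le> (y - x) * (y + x) * c"
        using f[of x y] that by (simp add: power2_eq_square algebra_simps)
      also have "\<dots> \<le> (y - x) * (2 * b) * c"
        using that \<open>c \<ge> 0\<close> by (intro mult_right_mono mult_left_mono) auto
      finally show ?thesis by (simp add: mult_ac)
    qed
    show "dist (f x) (f y) \<le> 2 * b * c * dist x y" if "x \<in> {0..b}" "y \<in> {0..b}" for x y
    proof (cases "x \<le> y")
      case True
      then show ?thesis using that key[of x y] by (simp add: dist_real_def)
    next
      case False
      then show ?thesis using that key[of y x] by (simp add: dist_real_def abs_minus_commute)
    qed
  qed (use \<open>c \<ge> 0\<close> that in simp)
  have "continuous_on {0<..<b} f" if "b > 0" for b
    by (rule continuous_on_subset[OF lipschitz_on_continuous_on[OF lipschitz[OF that]]]) auto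
  then have "continuous_on (\<Union>b\<in>{0<..}. {0<..<b}) f"
    by (intro continuous_on_open_UN) auto
  moreover have "(\<Union>b\<in>{0<..}. {0<..<b}) = {0::real<..}"
  proof (intro antisym subsetI)
    fix x :: real assume "x \<in> {0<..}"
    then show "x \<in> (\<Union>b\<in>{0<..}. {0<..<b})" by (intro UN_I[of "x + 1"]) auto
  qed auto
  ultimately show ?thesis by simp
qed

lemma exp_le_exp_add_diff:
  fixes x y :: real
  assumes "y \<le> x" "x \<le> 0"
  shows "exp x \<le> exp y + (x - y)"
proof -
  have "exp x - exp y = exp x * (1 - exp (y - x))" by (simp add: algebra_simps exp_diff)
  also have "\<dots> \<le> 1 - exp (y - x)"
    using assms by (intro mult_left_le_one_le) auto
  also have "\<dots> \<le> x - y" using exp_ge_add_one_self[of "y - x"] by linarith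
  finally show ?thesis by simp
qed

section \<open>Gaussian integrals over a set in an annulus\<close>

definition gauss_mass :: "'a::real_normed_vector measure \<Rightarrow> 'a set \<Rightarrow> real \<Rightarrow> ennreal" where
  "gauss_mass \<mu> G t = (\<integral>\<^sup>+y. indicator G y * ennreal (exp (- (t * norm y)\<^sup>2 / 2)) \<partial>\<mu>)"

lemma gauss_mass_le:
  assumes "G \<in> sets \<mu>" "\<And>y. y \<in> G \<Longrightarrow> 1 \<le> norm y"
  shows "gauss_mass \<mu> G t \<le> ennreal (exp (- t\<^sup>2 / 2)) * emeasure \<mu> G"
proof -
  have "gauss_mass \<mu> G t \<le> (\<integral>\<^sup>+y. ennreal (exp (- t\<^sup>2 / 2)) * indicator G y \<partial>\<mu>)"
    unfolding gauss_mass_def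
  proof (rule nn_integral_mono)
    fix y
    show "indicator G y * ennreal (exp (- (t * norm y)\<^sup>2 / 2)) \<le> ennreal (exp (- t\<^sup>2 / 2)) * indicator G y"
    proof (cases "y \<in> G")
      case True
      then have "t\<^sup>2 * 1 \<le> t\<^sup>2 * (norm y)\<^sup>2"
        using assms(2) by (intro mult_left_mono) (auto simp: one_le_power)
      then show ?thesis using True by (simp add: power_mult_distrib ennreal_leI)
    qed simp
  qed
  then show ?thesis using assms(1) by (simp add: nn_integral_cmult_indicator)
qed

lemma gauss_mass_ge:
  assumes "G \<in> sets \<mu>" "\<And>y. y \<in> G \<Longrightarrow> norm y \<le> R"
  shows "ennreal (exp (- (t * R)\<^sup>2 / 2)) * emeasure \<mu> G \<le> gauss_mass \<mu> G t"
proof -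
  have "(\<integral>\<^sup>+y. ennreal (exp (- (t * R)\<^sup>2 / 2)) * indicator G y \<partial>\<mu>) \<le> gauss_mass \<mu> G t"
    unfolding gauss_mass_def
  proof (rule nn_integral_mono)
    fix y
    show "ennreal (exp (- (t * R)\<^sup>2 / 2)) * indicator G y \<le> indicator G y * ennreal (exp (- (t * norm y)\<^sup>2 / 2))"
    proof (cases "y \<in> G")
      case True
      then have "t\<^sup>2 * (norm y)\<^sup>2 \<le> t\<^sup>2 * R\<^sup>2"
        using assms(2) by (intro mult_left_mono power_mono) auto
      then show ?thesis using True by (simp add: power_mult_distrib ennreal_leI)
    qed simp
  qed
  then show ?thesis using assms(1) by (simp add: nn_integral_cmult_indicator)
qed

lemma gauss_mass_antimono:
  assumes "0 \<le> a" "a \<le> b"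
  shows "gauss_mass \<mu> G b \<le> gauss_mass \<mu> G a"
  unfolding gauss_mass_def
proof (rule nn_integral_mono)
  fix y :: 'a
  have "a\<^sup>2 * (norm y)\<^sup>2 \<le> b\<^sup>2 * (norm y)\<^sup>2"
    using assms by (intro mult_right_mono power_mono) auto
  then show "indicator G y * ennreal (exp (- (b * norm y)\<^sup>2 / 2)) \<le> indicator G y * ennreal (exp (- (a * norm y)\<^sup>2 / 2))"
    by (intro mult_left_mono ennreal_leI) (simp_all add: power_mult_distrib)
qed

lemma exp_gauss_le_add:
  fixes a b r R :: real
  assumes "0 \<le> a" "a \<le> b" "0 \<le> r" "r \<le> R"
  shows "exp (- (a * r)\<^sup>2 / 2) \<le> exp (- (b * r)\<^sup>2 / 2) + (b\<^sup>2 - a\<^sup>2) * R\<^sup>2 / 2"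
proof -
  have ab: "a\<^sup>2 \<le> b\<^sup>2" using assms by (simp add: power_mono)
  have "a\<^sup>2 * r\<^sup>2 \<le> b\<^sup>2 * r\<^sup>2" using ab by (rule mult_right_mono) simp
  then have "exp (- (a * r)\<^sup>2 / 2) \<le> exp (- (b * r)\<^sup>2 / 2) + (- (a * r)\<^sup>2 / 2 - - (b * r)\<^sup>2 / 2)"
    by (intro exp_le_exp_add_diff) (simp_all add: power_mult_distrib)
  also have "- (a * r)\<^sup>2 / 2 - - (b * r)\<^sup>2 / 2 = (b\<^sup>2 - a\<^sup>2) * r\<^sup>2 / 2"
    by (simp add: power_mult_distrib algebra_simps)
  also have "\<dots> \<le> (b\<^sup>2 - a\<^sup>2) * R\<^sup>2 / 2"
    using assms ab by (intro divide_right_mono mult_left_mono power_mono) auto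
  finally show ?thesis by simp
qed

lemma gauss_mass_le_add:
  fixes \<mu> :: "'a::euclidean_space measure"
  assumes "sets \<mu> = sets borel" "G \<in> sets borel" "\<And>y. y \<in> G \<Longrightarrow> norm y \<le> R"
    and "0 \<le> a" "a \<le> b"
  shows "gauss_mass \<mu> G a \<le> gauss_mass \<mu> G b + ennreal ((b\<^sup>2 - a\<^sup>2) * R\<^sup>2 / 2) * emeasure \<mu> G"
proof -
  have ab: "0 \<le> (b\<^sup>2 - a\<^sup>2) * R\<^sup>2 / 2" using assms by (simp add: power_mono)
  have "gauss_mass \<mu> G a \<le> (\<integral>\<^sup>+y. indicator G y * ennreal (exp (- (b * norm y)\<^sup>2 / 2))
      + ennreal ((b\<^sup>2 - a\<^sup>2) * R\<^sup>2 / 2) * indicator G y \<partial>\<mu>)"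
    unfolding gauss_mass_def
  proof (rule nn_integral_mono)
    fix y
    show "indicator G y * ennreal (exp (- (a * norm y)\<^sup>2 / 2))
        \<le> indicator G y * ennreal (exp (- (b * norm y)\<^sup>2 / 2)) + ennreal ((b\<^sup>2 - a\<^sup>2) * R\<^sup>2 / 2) * indicator G y"
    proof (cases "y \<in> G")
      case True
      then have "ennreal (exp (- (a * norm y)\<^sup>2 / 2)) \<le> ennreal (exp (- (b * norm y)\<^sup>2 / 2) + (b\<^sup>2 - a\<^sup>2) * R\<^sup>2 / 2)"
        using assms exp_gauss_le_add[of a b "norm y" R] by (intro ennreal_leI) simp
      then show ?thesis using True ab by (simp add: ennreal_plus)
    qed simp
  qed
  also have "\<dots> = gauss_mass \<mu> G b + (\<integral>\<^sup>+y. ennreal ((b\<^sup>2 - a\<^sup>2) * R\<^sup>2 / 2) * indicator G y \<partial>\<mu>)"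
  proof -
    have "(\<lambda>y. indicator G y * ennreal (exp (- (b * norm y)\<^sup>2 / 2))) \<in> borel_measurable borel"
      using assms(2) by measurable
    moreover have "(\<lambda>y. ennreal ((b\<^sup>2 - a\<^sup>2) * R\<^sup>2 / 2) * indicator G y) \<in> borel_measurable borel"
      using assms(2) by measurable
    ultimately show ?thesis
      unfolding gauss_mass_def by (intro nn_integral_add) (simp_all add: measurable_cong_sets[OF assms(1) refl])
  qed
  also have "\<dots> = gauss_mass \<mu> G b + ennreal ((b\<^sup>2 - a\<^sup>2) * R\<^sup>2 / 2) * emeasure \<mu> G"
    using assms(1,2) by (simp add: nn_integral_cmult_indicator)
  finally show ?thesis .
qed

context
  fixes \<mu> :: "'a::euclidean_space measure" and G :: "'a set" and R m :: real
  assumes sets: "sets \<mu> = sets borel" "G \<in> sets borel"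
    and lower: "\<And>y. y \<in> G \<Longrightarrow> 1 \<le> norm y" and upper: "\<And>y. y \<in> G \<Longrightarrow> norm y \<le> R"
    and finite: "emeasure \<mu> G = ennreal m" "m > 0"
begin

lemma gauss_mass_le_finite: "gauss_mass \<mu> G t \<le> ennreal (exp (- t\<^sup>2 / 2) * m)"
proof -
  have "G \<in> sets \<mu>" using sets by simp
  from gauss_mass_le[OF this lower, of t] show ?thesis using finite(1) by (simp add: ennreal_mult')
qed

lemma gauss_mass_eq_ennreal: "gauss_mass \<mu> G t = ennreal (enn2real (gauss_mass \<mu> G t))"
proof -
  have "gauss_mass \<mu> G t \<noteq> \<infinity>" using gauss_mass_le_finite[of t] by (auto simp: top_unique)
  then show ?thesis by (simp add: ennreal_enn2real_if)
qed

lemma enn2real_gauss_mass_le: "enn2real (gauss_mass \<mu> G t) \<le> exp (- t\<^sup>2 / 2) * m"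
  using gauss_mass_le_finite[of t] finite(2) by (subst (asm) gauss_mass_eq_ennreal) simp

lemma enn2real_gauss_mass_pos: "0 < enn2real (gauss_mass \<mu> G t)"
proof -
  have "G \<in> sets \<mu>" using sets by simp
  from gauss_mass_ge[OF this upper, of t]
  have "ennreal (exp (- (t * R)\<^sup>2 / 2) * m) \<le> ennreal (enn2real (gauss_mass \<mu> G t))"
    using finite by (simp add: ennreal_mult' flip: gauss_mass_eq_ennreal)
  then have "exp (- (t * R)\<^sup>2 / 2) * m \<le> enn2real (gauss_mass \<mu> G t)" by simp
  moreover have "0 < exp (- (t * R)\<^sup>2 / 2) * m" using finite(2) by simp
  ultimately show ?thesis by linarith
qed

lemma enn2real_gauss_mass_diff:
  assumes ab: "0 \<le> a" "a \<le> b"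
  shows "\<bar>enn2real (gauss_mass \<mu> G a) - enn2real (gauss_mass \<mu> G b)\<bar> \<le> (b\<^sup>2 - a\<^sup>2) * (R\<^sup>2 * m / 2)"
proof -
  define j where "j t = enn2real (gauss_mass \<mu> G t)" for t
  have j: "gauss_mass \<mu> G t = ennreal (j t)" "0 \<le> j t" for t
    unfolding j_def by (simp_all flip: gauss_mass_eq_ennreal)
  define c where "c = (b\<^sup>2 - a\<^sup>2) * R\<^sup>2 / 2"
  have c: "0 \<le> c" "0 \<le> c * m" using ab finite(2) by (simp_all add: c_def power_mono)
  have "ennreal (j b) \<le> ennreal (j a)"
    using gauss_mass_antimono[OF ab, where \<mu>=\<mu> and G=G] by (simp add: j)
  then have "j b \<le> j a" using j(2) by simp
  have "gauss_mass \<mu> G a \<le> gauss_mass \<mu> G b + ennreal c * emeasure \<mu> G"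
    unfolding c_def by (rule gauss_mass_le_add[OF sets upper ab])
  also have "\<dots> = ennreal (j b + c * m)"
    using c j(2) finite by (simp add: j ennreal_plus ennreal_mult')
  finally have "ennreal (j a) \<le> ennreal (j b + c * m)" by (simp only: j)
  then have "j a \<le> j b + c * m"
    by (simp only: ennreal_le_iff[OF add_nonneg_nonneg[OF j(2) c(2)]])
  with \<open>j b \<le> j a\<close> show ?thesis by (simp add: j_def c_def)
qed

lemma not_inj_on_powr_gauss_mass:
  assumes "q > 0"
  shows "\<not> inj_on (\<lambda>t. t powr q * enn2real (gauss_mass \<mu> G t)) {0<..}"
proof (rule not_inj_on_if_vanishing_at_0_and_top)
  have "continuous_on {0<..} (\<lambda>t. enn2real (gauss_mass \<mu> G t))"
    by (rule continuous_on_if_diff_le_diff_squares[OF enn2real_gauss_mass_diff])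
      (use finite in simp_all)
  then show "continuous_on {0<..} (\<lambda>t. t powr q * enn2real (gauss_mass \<mu> G t))"
    by (intro continuous_intros) auto
  show "t powr q * enn2real (gauss_mass \<mu> G t) > 0" if "t > 0" for t
    using enn2real_gauss_mass_pos[of t] that by simp
  have nonneg: "0 \<le> t powr q * enn2real (gauss_mass \<mu> G t)" for t
    by simp
  have le_top: "t powr q * enn2real (gauss_mass \<mu> G t) \<le> t powr q * exp (- t\<^sup>2 / 2) * m" for t
    using enn2real_gauss_mass_le[of t] by (simp add: mult.assoc mult_left_mono)
  have le_0: "t powr q * enn2real (gauss_mass \<mu> G t) \<le> t powr q * m" for t
  proof -
    have "t powr q * exp (- t\<^sup>2 / 2) * m \<le> t powr q * 1 * m"
      using finite(2) by (intro mult_right_mono mult_left_mono) auto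
    then show ?thesis using le_top[of t] by simp
  qed
  have lim_0: "((\<lambda>t. t powr q * m) \<longlongrightarrow> 0) (at_right 0)" using \<open>q > 0\<close> by real_asymp
  show "((\<lambda>t. t powr q * enn2real (gauss_mass \<mu> G t)) \<longlongrightarrow> 0) (at_right 0)"
    by (rule tendsto_sandwich[OF always_eventually always_eventually tendsto_const lim_0])
      (use nonneg le_0 in auto)
  have lim_top: "((\<lambda>t. t powr q * exp (- t\<^sup>2 / 2) * m) \<longlongrightarrow> 0) at_top" by real_asymp
  show "((\<lambda>t. t powr q * enn2real (gauss_mass \<mu> G t)) \<longlongrightarrow> 0) at_top"
    by (rule tendsto_sandwich[OF always_eventually always_eventually tendsto_const lim_top])
      (use nonneg le_top in auto)
qed

end

text \<open>If the mass of \<open>G\<close> is zero or infinite, all the weighted masses agree.\<close>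
lemma ex_powr_gauss_mass_eq:
  fixes \<mu> :: "'a::euclidean_space measure"
  assumes sets: "sets \<mu> = sets borel" "G \<in> sets borel"
    and annulus: "\<And>y. y \<in> G \<Longrightarrow> 1 \<le> norm y \<and> norm y \<le> R" and "q > 0"
  obtains t1 t2 where "0 < t1" "0 < t2" "t1 \<noteq> t2"
    "ennreal (t1 powr q) * gauss_mass \<mu> G t1 = ennreal (t2 powr q) * gauss_mass \<mu> G t2"
proof -
  have G: "G \<in> sets \<mu>" using sets by simp
  have lower: "\<And>y. y \<in> G \<Longrightarrow> 1 \<le> norm y" and upper: "\<And>y. y \<in> G \<Longrightarrow> norm y \<le> R"
    using annulus by auto
  consider "emeasure \<mu> G = 0" | "emeasure \<mu> G = \<infinity>" | m where "emeasure \<mu> G = ennreal m" "m > 0"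
    by (cases "emeasure \<mu> G") (auto simp: le_less)
  then show ?thesis
  proof cases
    case 1
    then have "gauss_mass \<mu> G t = 0" for t
      using gauss_mass_le[OF G lower, of t] by simp
    then show ?thesis using that[of 1 2] by simp
  next
    case 2
    then have "gauss_mass \<mu> G t = \<infinity>" for t
      using gauss_mass_ge[OF G upper, of t] by (simp add: ennreal_mult_eq_top_iff top_unique)
    then show ?thesis using that[of 1 2] by (simp add: ennreal_mult_top)
  next
    case 3
    then obtain t1 t2 where t: "0 < t1" "0 < t2" "t1 \<noteq> t2"
      and eq: "t1 powr q * enn2real (gauss_mass \<mu> G t1) = t2 powr q * enn2real (gauss_mass \<mu> G t2)"
      using not_inj_on_powr_gauss_mass[OF sets lower upper 3 \<open>q > 0\<close>] unfolding inj_on_def by auto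
    have "ennreal (t powr q) * gauss_mass \<mu> G t = ennreal (t powr q * enn2real (gauss_mass \<mu> G t))" for t
    proof -
      have "ennreal (t powr q) * gauss_mass \<mu> G t = ennreal (t powr q) * ennreal (enn2real (gauss_mass \<mu> G t))"
        using gauss_mass_eq_ennreal[OF sets lower upper 3, of t] by (rule arg_cong)
      also have "\<dots> = ennreal (t powr q * enn2real (gauss_mass \<mu> G t))"
        by (rule ennreal_mult[symmetric]) simp_all
      finally show ?thesis .
    qed
    then show ?thesis using that[OF t] eq by (simp only:)
  qed
qed

section \<open>Truncating the cone by a hyperplane with normal in \<open>\<Omega>\<close>\<close>

lemma polar_cone_interior_bound:
  fixes C :: "'a::euclidean_space set"
  assumes "u \<in> interior (polar_cone C)"
  obtains r where "r > 0" "\<And>x. x \<in> C \<Longrightarrow> u \<bullet> x \<le> - r * norm x"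
proof -
  obtain e where e: "e > 0" "ball u e \<subseteq> polar_cone C" using assms mem_interior by blast
  have "u \<bullet> x \<le> - (e/2) * norm x" if x: "x \<in> C" for x
  proof (cases "x = 0")
    case False
    have "u + (e/2) *\<^sub>R (x /\<^sub>R norm x) \<in> polar_cone C"
      using e False by (intro subsetD[OF e(2)]) (simp add: dist_norm)
    then have "(u + (e/2) *\<^sub>R (x /\<^sub>R norm x)) \<bullet> x \<le> 0" using x unfolding polar_cone_def by auto
    then show ?thesis using False by (simp add: inner_add_left dot_square_norm power2_eq_square field_simps)
  qed simp
  then show ?thesis using that[of "e/2"] e by simp
qed

lemma inner_interior_polar_cone_neg:
  fixes C :: "'a::euclidean_space set"
  assumes "w \<in> interior (polar_cone C)" "x \<in> C" "x \<noteq> 0"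
  shows "w \<bullet> x < 0"
proof -
  obtain r where "r > 0" "w \<bullet> x \<le> - r * norm x"
    using polar_cone_interior_bound[OF assms(1)] assms(2) by metis
  moreover have "r * norm x > 0" using \<open>r > 0\<close> assms(3) by simp
  ultimately show ?thesis by linarith
qed

lemma scaleR_mem_interior_cone_iff:
  fixes C :: "'a::euclidean_space set"
  assumes "cone C" "c > 0"
  shows "c *\<^sub>R x \<in> interior C \<longleftrightarrow> x \<in> interior C"
proof (cases "C = {}")
  case False
  have inj: "inj ((*\<^sub>R) c :: 'a \<Rightarrow> 'a)" using assms(2) injective_scaleR[of c] by simp
  moreover have "(*\<^sub>R) c ` C = C" using cone_iff[OF False] assms by auto
  then have "interior C = interior ((*\<^sub>R) c ` C)" by simp
  ultimately have interior_eq: "interior C = (*\<^sub>R) c ` interior C"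
    by (simp add: interior_injective_linear_image linear_scaleR)
  have "c *\<^sub>R x \<in> interior C \<longleftrightarrow> c *\<^sub>R x \<in> (*\<^sub>R) c ` interior C"
    by (subst (1) interior_eq) (rule refl)
  also have "\<dots> \<longleftrightarrow> x \<in> interior C" by (rule inj_image_mem_iff[OF inj])
  finally show ?thesis .
qed simp

lemma exists_unit_normal_not_rel_interior:
  fixes C :: "'a::euclidean_space set"
  assumes "convex C" "x \<in> C" "x \<notin> rel_interior C"
  obtains v where "norm v = 1" "\<And>y. y \<in> C \<Longrightarrow> v \<bullet> y \<le> v \<bullet> x"
proof -
  obtain a where a: "a \<noteq> 0" "\<And>y. y \<in> C \<Longrightarrow> a \<bullet> x \<le> a \<bullet> y"
    using supporting_hyperplane_rel_boundary[OF assms] by metis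
  show ?thesis
  proof (rule that[of "- (1 / norm a) *\<^sub>R a"])
    show "norm (- (1 / norm a) *\<^sub>R a) = 1" using a(1) by simp
    show "(- (1 / norm a) *\<^sub>R a) \<bullet> y \<le> (- (1 / norm a) *\<^sub>R a) \<bullet> x" if "y \<in> C" for y
      using a(2)[OF that] by (simp add: divide_right_mono)
  qed
qed

text \<open>Testing an outer normal \<open>w\<close> against \<open>x - (e/2) u\<close> gives \<open>w \<bullet> u \<ge> 0\<close>; testing it
  against \<open>x\<close> moved along the component of \<open>w\<close> orthogonal to \<open>u\<close> shows that this component
  vanishes.\<close>
lemma outer_unit_normals_locally_halfspace:
  fixes K :: "'a::euclidean_space set"
  assumes u: "norm u = 1" and "e > 0"
    and K: "K \<subseteq> {y. u \<bullet> y \<le> u \<bullet> x}" "ball x e \<inter> {y. u \<bullet> y \<le> u \<bullet> x} \<subseteq> K"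
  shows "outer_unit_normals K x = {u}"
proof (intro antisym subsetI)
  fix w assume "w \<in> outer_unit_normals K x"
  then have norm_w: "norm w = 1" and normal: "\<And>y. y \<in> K \<Longrightarrow> w \<bullet> y \<le> w \<bullet> x"
    unfolding outer_unit_normals_def by auto
  have near: "w \<bullet> y \<le> w \<bullet> x" if "dist x y < e" "u \<bullet> y \<le> u \<bullet> x" for y
    using that K(2) by (intro normal) auto
  have "w \<bullet> (x - (e/2) *\<^sub>R u) \<le> w \<bullet> x"
    using u \<open>e > 0\<close> by (intro near) (simp_all add: dist_norm inner_diff_right)
  then have w_u: "w \<bullet> u \<ge> 0" using \<open>e > 0\<close> by (simp add: inner_diff_right zero_le_mult_iff)
  define w0 where "w0 = w - (w \<bullet> u) *\<^sub>R u"
  have u_w0: "u \<bullet> w0 = 0" using u by (simp add: w0_def inner_diff_right dot_square_norm inner_commute)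
  have "w0 = 0"
  proof (rule ccontr)
    assume "w0 \<noteq> 0"
    have "w \<bullet> (x + (e/2) *\<^sub>R (w0 /\<^sub>R norm w0)) \<le> w \<bullet> x"
      using \<open>w0 \<noteq> 0\<close> \<open>e > 0\<close> u_w0 by (intro near) (simp_all add: dist_norm inner_add_right)
    then have "w \<bullet> w0 \<le> 0"
      using \<open>w0 \<noteq> 0\<close> \<open>e > 0\<close> by (simp add: inner_add_right zero_le_mult_iff mult_le_0_iff)
    moreover have "w \<bullet> w0 = w0 \<bullet> w0"
      using u_w0 by (simp add: w0_def inner_diff_left inner_commute)
    ultimately show False using \<open>w0 \<noteq> 0\<close> by (metis inner_gt_zero_iff not_le)
  qed
  then have "w = (w \<bullet> u) *\<^sub>R u" by (simp add: w0_def)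
  moreover from this have "\<bar>w \<bullet> u\<bar> = 1" using norm_w u by (metis norm_scaleR mult_1_right real_norm_def)
  ultimately show "w \<in> {u}" using w_u by simp
qed (use assms in \<open>auto simp: outer_unit_normals_def\<close>)

locale cone_truncation =
  fixes C :: "'a::euclidean_space set" and u :: 'a
  assumes pointed_full_cone: "pointed_full_cone C" and u_Omega: "u \<in> Omega C"
begin

definition truncation :: "real \<Rightarrow> 'a set" where
  "truncation t = C \<inter> {x. u \<bullet> x \<le> - t}"

definition facet :: "real \<Rightarrow> 'a set" where
  "facet t = interior C \<inter> {x. u \<bullet> x = - t}"

lemma cone_C: "cone C" and convex_C: "convex C" and closed_C: "closed C"
  and aff_dim_C: "aff_dim C = int DIM('a)"
  using pointed_full_cone unfolding pointed_full_cone_def by auto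

lemma norm_u: "norm u = 1" and u_interior_polar: "u \<in> interior (polar_cone C)"
  using u_Omega unfolding Omega_def by auto

lemma scaleR_mem_C: "x \<in> C \<Longrightarrow> 0 \<le> c \<Longrightarrow> c *\<^sub>R x \<in> C"
  using cone_C unfolding cone_def by blast

lemma add_mem_C:
  assumes "x \<in> C" "y \<in> C"
  shows "x + y \<in> C"
proof -
  have "(1/2) *\<^sub>R x + (1/2) *\<^sub>R y \<in> C" by (rule convexD[OF convex_C assms]) simp_all
  then have "2 *\<^sub>R ((1/2) *\<^sub>R x + (1/2) *\<^sub>R y) \<in> C" by (rule scaleR_mem_C) simp
  then show ?thesis by (simp add: scaleR_add_right)
qed

lemma inner_u_neg: "x \<in> C \<Longrightarrow> x \<noteq> 0 \<Longrightarrow> u \<bullet> x < 0"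
  by (rule inner_interior_polar_cone_neg[OF u_interior_polar])

lemma exists_C_inner_u_eq:
  assumes "t \<ge> 0"
  shows "\<exists>y\<in>C. u \<bullet> y = - t"
proof -
  have "\<not> C \<subseteq> {0}"
  proof
    assume "C \<subseteq> {0}"
    then have "C = {} \<or> C = {0}" by auto
    then have "aff_dim C \<le> 0" by auto
    with aff_dim_C show False using DIM_positive[where 'a='a] by simp
  qed
  then obtain x where x: "x \<in> C" "x \<noteq> 0" by blast
  have "u \<bullet> x < 0" using x by (rule inner_u_neg)
  then have "u \<bullet> ((t / - (u \<bullet> x)) *\<^sub>R x) = - t" by simp
  moreover have "(t / - (u \<bullet> x)) *\<^sub>R x \<in> C"
    using \<open>u \<bullet> x < 0\<close> assms by (intro scaleR_mem_C x) (simp add: divide_nonneg_neg)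
  ultimately show ?thesis by blast
qed

lemma closed_truncation: "closed (truncation t)"
  unfolding truncation_def by (intro closed_Int closed_C closed_halfspace_le)

lemma convex_truncation: "convex (truncation t)"
  unfolding truncation_def by (intro convex_Int convex_C convex_halfspace_le)

lemma recession_cone_truncation:
  assumes "t > 0"
  shows "recession_cone (truncation t) = C"
proof (intro antisym subsetI)
  fix z assume "z \<in> C"
  then show "z \<in> recession_cone (truncation t)"
    using add_mem_C inner_u_neg[of z]
    by (cases "z = 0") (auto simp: recession_cone_def truncation_def inner_add_right)
next
  fix z assume "z \<in> recession_cone (truncation t)"
  then have step: "y \<in> truncation t \<Longrightarrow> y + z \<in> truncation t" for y
    unfolding recession_cone_def by auto
  obtain y where y: "y \<in> C" "u \<bullet> y = - t" using exists_C_inner_u_eq[of t] assms by auto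
  have orbit: "y + real n *\<^sub>R z \<in> truncation t" for n
  proof (induction n)
    case 0
    then show ?case using y by (simp add: truncation_def)
  next
    case (Suc n)
    then show ?case using step[of "y + real n *\<^sub>R z"] by (simp add: algebra_simps)
  qed
  have mem: "(1 / real (Suc n)) *\<^sub>R y + z \<in> C" for n
    using scaleR_mem_C[of "y + real (Suc n) *\<^sub>R z" "1 / real (Suc n)"] orbit[of "Suc n"]
    by (simp add: truncation_def scaleR_add_right)
  have "(\<lambda>n. (1 / real (Suc n)) *\<^sub>R y + z) \<longlonglongrightarrow> 0 *\<^sub>R y + z"
    by (intro tendsto_intros LIMSEQ_Suc[OF lim_const_over_n])
  then have "0 *\<^sub>R y + z \<in> C" by (rule closed_sequentially[OF closed_C mem])
  then show "z \<in> C" by simp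
qed

lemma pseudo_cone_truncation:
  assumes "t > 0"
  shows "pseudo_cone C (truncation t)"
  unfolding pseudo_cone_def
proof (intro conjI allI impI)
  obtain y where "y \<in> C" "u \<bullet> y = - t" using exists_C_inner_u_eq[of t] assms by auto
  then show "truncation t \<noteq> {}" by (auto simp: truncation_def)
  show "0 \<notin> truncation t" using assms by (simp add: truncation_def)
  show "(*\<^sub>R) l ` truncation t \<subseteq> truncation t" if "1 \<le> l" for l :: real
  proof
    fix x assume "x \<in> (*\<^sub>R) l ` truncation t"
    then obtain a where a: "a \<in> C" "u \<bullet> a \<le> - t" "x = l *\<^sub>R a" by (auto simp: truncation_def)
    have "l * (u \<bullet> a) \<le> 1 * (u \<bullet> a)"
      using that a(2) assms by (intro mult_right_mono_neg) auto
    then show "x \<in> truncation t" using a that scaleR_mem_C[of a l] by (simp add: truncation_def)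
  qed
qed (simp_all add: closed_truncation convex_truncation recession_cone_truncation assms)

lemma truncation_in_Kclass:
  assumes "t > 0" "\<omega> \<subseteq> Omega C" "u \<in> \<omega>"
  shows "truncation t \<in> Kclass C \<omega>"
proof -
  have "truncation t = C \<inter> (\<Inter>v\<in>\<omega>. {x. x \<bullet> v \<le> support_fun (truncation t) v})"
  proof (intro antisym subsetI)
    fix x assume x: "x \<in> truncation t"
    have "x \<bullet> v \<le> support_fun (truncation t) v" if "v \<in> \<omega>" for v
    proof -
      have "v \<in> polar_cone C" using that assms(2) interior_subset by (auto simp: Omega_def)
      then have "bdd_above ((\<lambda>y. v \<bullet> y) ` truncation t)"
        by (intro bdd_aboveI2[where M=0]) (auto simp: polar_cone_def truncation_def inner_commute)
      then have "v \<bullet> x \<le> support_fun (truncation t) v"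
        unfolding support_fun_def by (rule cSUP_upper[OF x])
      then show ?thesis by (simp add: inner_commute)
    qed
    then show "x \<in> C \<inter> (\<Inter>v\<in>\<omega>. {x. x \<bullet> v \<le> support_fun (truncation t) v})"
      using x by (auto simp: truncation_def)
  next
    fix x assume x: "x \<in> C \<inter> (\<Inter>v\<in>\<omega>. {x. x \<bullet> v \<le> support_fun (truncation t) v})"
    then have "x \<bullet> u \<le> support_fun (truncation t) u" using assms(3) by auto
    also have "support_fun (truncation t) u \<le> - t"
      unfolding support_fun_def using pseudo_cone_truncation[OF assms(1)]
      by (intro cSUP_least) (auto simp: truncation_def pseudo_cone_def)
    finally show "x \<in> truncation t" using x by (simp add: truncation_def inner_commute)
  qed
  then show ?thesis unfolding Kclass_def using pseudo_cone_truncation[OF assms(1)] by blast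
qed

lemma inj_on_truncation: "inj_on truncation {0<..}"
proof -
  have "truncation s \<noteq> truncation t" if st: "0 < s" "s < t" for s t
  proof -
    obtain y where "y \<in> C" "u \<bullet> y = - s" using exists_C_inner_u_eq[of s] st by auto
    then have "y \<in> truncation s" "y \<notin> truncation t" using st by (auto simp: truncation_def)
    then show ?thesis by blast
  qed
  then show ?thesis unfolding inj_on_def by (metis greaterThan_iff linorder_neqE_linordered_idom)
qed

lemma facet_subset_truncation: "facet t \<subseteq> truncation t"
  using interior_subset by (auto simp: facet_def truncation_def)

lemma outer_unit_normals_facet:
  assumes "x \<in> facet t"
  shows "outer_unit_normals (truncation t) x = {u}"
proof -
  have "x \<in> interior C" using assms by (simp add: facet_def)
  then obtain e where "e > 0" "ball x e \<subseteq> C" using mem_interior by blast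
  then show ?thesis using assms norm_u
    by (intro outer_unit_normals_locally_halfspace) (auto simp: facet_def truncation_def)
qed

lemma unit_normal_facet: "x \<in> facet t \<Longrightarrow> unit_normal (truncation t) x = u"
  by (simp add: unit_normal_def outer_unit_normals_facet)

lemma facet_subset_frontier: "facet t \<subseteq> frontier (truncation t)"
proof
  fix x assume x: "x \<in> facet t"
  have "x \<notin> interior (truncation t)"
  proof
    assume "x \<in> interior (truncation t)"
    then obtain e where "e > 0" "ball x e \<subseteq> truncation t" using mem_interior by blast
    moreover have "x + (e/2) *\<^sub>R u \<in> ball x e" using \<open>e > 0\<close> norm_u by (simp add: dist_norm)
    ultimately have "x + (e/2) *\<^sub>R u \<in> truncation t" by blast
    then show False
      using x \<open>e > 0\<close> norm_u by (simp add: truncation_def facet_def inner_add_right dot_square_norm)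
  qed
  then show "x \<in> frontier (truncation t)"
    using x facet_subset_truncation closure_subset by (auto simp: frontier_def)
qed

text \<open>At a nonzero point \<open>x\<close> of the boundary of \<open>C\<close> the cone has an outer normal \<open>v\<close>;
  it cannot lie in \<open>\<Omega>\<close>, since \<open>v \<bullet> x \<ge> v \<bullet> 0 = 0\<close>.\<close>
lemma mem_facet_if_unique_normal:
  assumes "t > 0" and x: "x \<in> frontier (truncation t)"
    and normals: "outer_unit_normals (truncation t) x = {w}" and w: "w \<in> Omega C"
  shows "x \<in> facet t"
proof -
  have "x \<in> truncation t" using x closed_truncation frontier_subset_closed by blast
  then have x_C: "x \<in> C" and x_u: "u \<bullet> x \<le> - t" by (auto simp: truncation_def)
  have "x \<in> interior C"
  proof (rule ccontr)
    assume "x \<notin> interior C"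
    moreover have "affine hull C = UNIV" using aff_dim_C aff_dim_eq_full by blast
    ultimately have "x \<notin> rel_interior C" by (simp add: rel_interior_interior)
    then obtain v where v: "norm v = 1" "\<And>y. y \<in> C \<Longrightarrow> v \<bullet> y \<le> v \<bullet> x"
      using exists_unit_normal_not_rel_interior[OF convex_C x_C] by blast
    then have "v \<in> outer_unit_normals (truncation t) x"
      by (auto simp: outer_unit_normals_def truncation_def)
    then have "v = w" using normals by simp
    have "0 \<in> C" using cone_contains_0[OF cone_C] x_C by blast
    then have "0 \<le> w \<bullet> x" using v(2)[of 0] \<open>v = w\<close> by simp
    moreover have "w \<bullet> x < 0"
      using w x_C x_u \<open>t > 0\<close> by (intro inner_interior_polar_cone_neg) (auto simp: Omega_def)
    ultimately show False by simp
  qed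
  moreover have "u \<bullet> x = - t"
  proof (rule ccontr)
    assume "u \<bullet> x \<noteq> - t"
    have "interior C \<inter> {y. u \<bullet> y < - t} \<subseteq> interior (truncation t)"
      using interior_subset
      by (intro interior_maximal open_Int open_interior open_halfspace_lt) (auto simp: truncation_def)
    then have "x \<in> interior (truncation t)"
      using \<open>x \<in> interior C\<close> x_u \<open>u \<bullet> x \<noteq> - t\<close> by auto
    then show False using x by (simp add: frontier_def)
  qed
  ultimately show ?thesis by (simp add: facet_def)
qed

lemma inv_normal_truncation:
  assumes "t > 0" "\<eta> \<subseteq> Omega C"
  shows "inv_normal (truncation t) \<eta> = (if u \<in> \<eta> then facet t else {})"
proof (intro antisym subsetI)
  fix x assume "x \<in> inv_normal (truncation t) \<eta>"
  then obtain w where x: "x \<in> frontier (truncation t)" "outer_unit_normals (truncation t) x = {w}" "w \<in> \<eta>"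
    unfolding inv_normal_def by blast
  then have "x \<in> facet t" using mem_facet_if_unique_normal assms by blast
  moreover from this have "w = u" using x(2) outer_unit_normals_facet by simp
  ultimately show "x \<in> (if u \<in> \<eta> then facet t else {})" using x(3) by simp
qed (use facet_subset_frontier outer_unit_normals_facet in \<open>auto simp: inv_normal_def split: if_splits\<close>)

lemma facet_borel: "facet t \<in> sets borel"
  unfolding facet_def by (intro sets.Int borel_open borel_closed open_interior closed_hyperplane)

lemma scaleR_mem_facet_iff:
  assumes "t > 0"
  shows "t *\<^sub>R y \<in> facet t \<longleftrightarrow> y \<in> facet 1"
proof -
  have "t * (u \<bullet> y) = - t \<longleftrightarrow> t * (u \<bullet> y + 1) = 0" by (simp add: algebra_simps eq_neg_iff_add_eq_0)
  then have "t * (u \<bullet> y) = - t \<longleftrightarrow> u \<bullet> y = - 1" using assms by auto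
  then show ?thesis using assms by (simp add: facet_def scaleR_mem_interior_cone_iff[OF cone_C])
qed

lemma facet_annulus:
  obtains R where "\<And>y. y \<in> facet 1 \<Longrightarrow> 1 \<le> norm y \<and> norm y \<le> R"
proof -
  obtain r where r: "r > 0" "\<And>x. x \<in> C \<Longrightarrow> u \<bullet> x \<le> - r * norm x"
    using polar_cone_interior_bound[OF u_interior_polar] by blast
  have "1 \<le> norm y \<and> norm y \<le> 1 / r" if y: "y \<in> facet 1" for y
  proof
    have "y \<in> C" "u \<bullet> y = -1" using y interior_subset by (auto simp: facet_def)
    then show "1 \<le> norm y"
      using Cauchy_Schwarz_ineq2[of u y] norm_u by simp
    have "r * norm y \<le> 1" using r(2)[OF \<open>y \<in> C\<close>] \<open>u \<bullet> y = -1\<close> by simp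
    then show "norm y \<le> 1 / r" using r(1) by (simp add: field_simps)
  qed
  then show ?thesis using that by blast
qed

lemma nn_integral_facet:
  assumes "t > 0"
  shows "(\<integral>\<^sup>+x. indicator (facet t) x * ennreal (t powr (1 - p) * exp (- (norm x)\<^sup>2 / 2)) \<partial>hausdorff_measure (DIM('a) - 1))
    = ennreal (t powr (real DIM('a) - p)) * gauss_mass (hausdorff_measure (DIM('a) - 1)) (facet 1) t"
proof -
  let ?H = "hausdorff_measure (DIM('a) - 1) :: 'a measure"
  have "(\<lambda>x. indicator (facet t) x * ennreal (t powr (1 - p) * exp (- (norm x)\<^sup>2 / 2))) \<in> borel_measurable borel"
    using facet_borel[of t] by measurable
  note scale = nn_integral_hausdorff_measure_scaleR[OF this assms, of "DIM('a) - 1"]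
  have rescale: "indicator (facet t) (t *\<^sub>R y) * ennreal (t powr (1 - p) * exp (- (norm (t *\<^sub>R y))\<^sup>2 / 2))
      = ennreal (t powr (1 - p)) * (indicator (facet 1) y * ennreal (exp (- (t * norm y)\<^sup>2 / 2)))" for y
  proof -
    have "indicator (facet t) (t *\<^sub>R y) = (indicator (facet 1) y :: ennreal)"
      using scaleR_mem_facet_iff[OF assms] by (simp add: indicator_def)
    moreover have "\<bar>t\<bar> = t" using assms by simp
    ultimately show ?thesis by (simp add: ennreal_mult mult_ac)
  qed
  then have integral_eq: "(\<integral>\<^sup>+y. indicator (facet t) (t *\<^sub>R y) * ennreal (t powr (1 - p) * exp (- (norm (t *\<^sub>R y))\<^sup>2 / 2)) \<partial>?H)
      = ennreal (t powr (1 - p)) * gauss_mass ?H (facet 1) t"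
  proof -
    have "(\<lambda>y. indicator (facet 1) y * ennreal (exp (- (t * norm y)\<^sup>2 / 2))) \<in> borel_measurable ?H"
      using facet_borel[of 1] by measurable
    then show ?thesis
      unfolding gauss_mass_def rescale by (rule nn_integral_cmult)
  qed
  have power: "ennreal (t ^ (DIM('a) - 1)) * ennreal (t powr (1 - p)) = ennreal (t powr (real DIM('a) - p))"
  proof -
    have "real (DIM('a) - 1) = real DIM('a) - 1" using DIM_positive[where 'a='a] by linarith
    then have "t ^ (DIM('a) - 1) * t powr (1 - p) = t powr (real DIM('a) - p)"
      using assms by (simp add: powr_realpow[symmetric] powr_add[symmetric])
    then show ?thesis using assms by (simp flip: ennreal_mult)
  qed
  show ?thesis unfolding scale integral_eq mult.assoc[symmetric] power ..
qed

lemma gauss_Lp_area_truncation: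
  assumes "t > 0" "\<eta> \<subseteq> Omega C"
  shows "gauss_Lp_area p (truncation t) \<eta> =
    (if u \<in> \<eta> then ennreal ((2 * pi) powr (- real DIM('a) / 2)) * ennreal (t powr (real DIM('a) - p))
       * gauss_mass (hausdorff_measure (DIM('a) - 1)) (facet 1) t
     else 0)"
proof (cases "u \<in> \<eta>")
  case True
  have integrand: "indicator (inv_normal (truncation t) \<eta>) x
        * ennreal (\<bar>x \<bullet> unit_normal (truncation t) x\<bar> powr (1 - p) * exp (- (norm x)\<^sup>2 / 2))
      = indicator (facet t) x * ennreal (t powr (1 - p) * exp (- (norm x)\<^sup>2 / 2))" for x
  proof (cases "x \<in> facet t")
    case True
    then have "\<bar>x \<bullet> unit_normal (truncation t) x\<bar> = t"
      using assms(1) by (simp add: unit_normal_facet facet_def inner_commute)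
    then show ?thesis using True \<open>u \<in> \<eta>\<close> by (simp add: inv_normal_truncation[OF assms])
  qed (simp add: inv_normal_truncation[OF assms] \<open>u \<in> \<eta>\<close>)
  have "(\<integral>\<^sup>+x. indicator (inv_normal (truncation t) \<eta>) x
        * ennreal (\<bar>x \<bullet> unit_normal (truncation t) x\<bar> powr (1 - p) * exp (- (norm x)\<^sup>2 / 2))
        \<partial>hausdorff_measure (DIM('a) - 1))
      = (\<integral>\<^sup>+x. indicator (facet t) x * ennreal (t powr (1 - p) * exp (- (norm x)\<^sup>2 / 2))
        \<partial>hausdorff_measure (DIM('a) - 1))"
    by (rule nn_integral_cong) (rule integrand)
  also have "\<dots> = ennreal (t powr (real DIM('a) - p)) * gauss_mass (hausdorff_measure (DIM('a) - 1)) (facet 1) t"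
    by (rule nn_integral_facet[OF assms(1)])
  finally show ?thesis
    using True unfolding gauss_Lp_area_def by (simp only: if_True mult.assoc)
qed (simp add: gauss_Lp_area_def inv_normal_truncation[OF assms])

end

theorem mainTheorem4:
  fixes C :: "'a::euclidean_space set" and \<omega> :: "'a set" and p :: real
  assumes "p < real DIM('a)"
    and "pointed_full_cone C"
    and "\<omega> \<noteq> {}" and "compact \<omega>" and "\<omega> \<subseteq> Omega C"
  shows "\<exists>K L. K \<in> Kclass C \<omega> \<and> L \<in> Kclass C \<omega> \<and> K \<noteq> L \<and>
           (\<forall>\<eta>. \<eta> \<in> sets borel \<longrightarrow> \<eta> \<subseteq> Omega C \<longrightarrow>
                 gauss_Lp_area p K \<eta> = gauss_Lp_area p L \<eta>)"
proof -
  obtain u where "u \<in> \<omega>" using assms(3) by blast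
  interpret cone_truncation C u using assms(2,5) \<open>u \<in> \<omega>\<close> by unfold_locales auto
  obtain R where annulus: "\<And>y. y \<in> facet 1 \<Longrightarrow> 1 \<le> norm y \<and> norm y \<le> R"
    using facet_annulus by blast
  have "real DIM('a) - p > 0" using assms(1) by simp
  obtain t1 t2 where t: "0 < t1" "0 < t2" "t1 \<noteq> t2" and eq:
    "ennreal (t1 powr (real DIM('a) - p)) * gauss_mass (hausdorff_measure (DIM('a) - 1)) (facet 1) t1
      = ennreal (t2 powr (real DIM('a) - p)) * gauss_mass (hausdorff_measure (DIM('a) - 1)) (facet 1) t2"
    using ex_powr_gauss_mass_eq[OF sets_hausdorff_measure facet_borel annulus \<open>real DIM('a) - p > 0\<close>]
    by blast
  show ?thesis
  proof (intro exI conjI allI impI)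
    show "truncation t1 \<in> Kclass C \<omega>" "truncation t2 \<in> Kclass C \<omega>"
      using truncation_in_Kclass t assms(5) \<open>u \<in> \<omega>\<close> by auto
    show "truncation t1 \<noteq> truncation t2" using inj_on_truncation t by (auto simp: inj_on_def)
    show "gauss_Lp_area p (truncation t1) \<eta> = gauss_Lp_area p (truncation t2) \<eta>" if "\<eta> \<subseteq> Omega C" for \<eta>
      using eq by (simp add: gauss_Lp_area_truncation t that mult.assoc)
  qed
qed

end
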